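(* Let $G$ be any graph on $n$ vertices. Then for every permutation $\pi$ of $V(G)$ and every $p\in\left(0,\frac{n+\gamma(G)}{2n}\right]$, one has $\gamma_p(\pi G)\le\gamma(G)$.
   Context: All graphs are finite, simple and undirected. For a graph $H$ and $S\subseteq V(H)$, $N[S]=N_H[S]$ denotes the closed neighborhood of $S$, i.e. $S$ together with all vertices adjacent to some vertex of $S$. The domination number $\gamma(H)$ is the minimum cardinality of a set $S\subseteq V(H)$ with $N[S]=V(H)$. For $p\in(0,1]$, a set $S\subseteq V(H)$ is a $p$-dominating set of $H$ if $|N[S]|/|V(H)|\ge p$; the $p$-domination number $\gamma_p(H)$ is the minimum cardinality of a $p$-dominating set of $H$. For a permutation $\pi$ of $V(G)$, the prism $\pi G$ is the graph on $2|V(G)|$ vertices obtained from two disjoint copies $G_1$ and $G_2$ of $G$ by joining, for each $v\in V(G)$, the copy of $v$ in $G_1$ to the copy of $\pi(v)$ in $G_2$ by an edge. *)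

theory Defs
  imports Complex_Main "HOL-Combinatorics.Permutations" "Graph_Theory.Pair_Digraph"
begin

(* Finite simple undirected graphs are modelled by the locale pair_graph: finite vertex set pverts,
   and parcs a symmetric irreflexive relation on it, so an undirected edge uv is the pair of arcs
   (u, v), (v, u). *)

definition closed_nbhd :: "'a pair_pre_digraph \<Rightarrow> 'a set \<Rightarrow> 'a set" where
  "closed_nbhd H S = S \<union> {v. \<exists>u\<in>S. (u, v) \<in> parcs H}"

definition dominating_set :: "'a pair_pre_digraph \<Rightarrow> 'a set \<Rightarrow> bool" where
  "dominating_set H S \<longleftrightarrow> S \<subseteq> pverts H \<and> closed_nbhd H S = pverts H"

definition domination_number :: "'a pair_pre_digraph \<Rightarrow> nat" where
  "domination_number H = (LEAST k. \<exists>S. dominating_set H S \<and> card S = k)"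

definition p_dominating_set :: "real \<Rightarrow> 'a pair_pre_digraph \<Rightarrow> 'a set \<Rightarrow> bool" where
  "p_dominating_set p H S \<longleftrightarrow>
     S \<subseteq> pverts H \<and> real (card (closed_nbhd H S)) / real (card (pverts H)) \<ge> p"

(* Meaningful for 0 < p \<le> 1 and nonempty H, where pverts H itself is p-dominating. *)
definition p_domination_number :: "real \<Rightarrow> 'a pair_pre_digraph \<Rightarrow> nat" where
  "p_domination_number p H = (LEAST k. \<exists>S. p_dominating_set p H S \<and> card S = k)"

definition prism :: "('a \<Rightarrow> 'a) \<Rightarrow> 'a pair_pre_digraph \<Rightarrow> ('a + 'a) pair_pre_digraph" where
  "prism \<pi> G =
     \<lparr> pverts = pverts G <+> pverts G,
       parcs = {(Inl u, Inl v) | u v. (u, v) \<in> parcs G}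
             \<union> {(Inr u, Inr v) | u v. (u, v) \<in> parcs G}
             \<union> {(Inl v, Inr (\<pi> v)) | v. v \<in> pverts G}
             \<union> {(Inr (\<pi> v), Inl v) | v. v \<in> pverts G} \<rparr>"

lemma pair_graph_prism:
  assumes "pair_graph G" and "\<pi> permutes pverts G"
  shows "pair_graph (prism \<pi> G)"
proof -
  interpret pair_graph G by fact
  have \<pi>: "\<pi> v \<in> pverts G \<longleftrightarrow> v \<in> pverts G" for v
    using permutes_in_image[OF assms(2)] .
  have E: "u \<in> pverts G \<and> v \<in> pverts G \<and> u \<noteq> v \<and> (v, u) \<in> parcs G"
    if "(u, v) \<in> parcs G" for u v
    using that in_arcsD1[OF that] in_arcsD2[OF that] pair_no_loops[OF that] pair_sym_arcs
    by (auto simp: symmetric_def dest: symD)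
  have sub: "parcs (prism \<pi> G) \<subseteq> pverts (prism \<pi> G) \<times> pverts (prism \<pi> G)"
    unfolding prism_def using E \<pi> by fastforce
  have sym: "sym (parcs (prism \<pi> G))"
    unfolding prism_def sym_def using E by fastforce
  have loops: "(x, x) \<notin> parcs (prism \<pi> G)" for x
    unfolding prism_def using E by fastforce
  have fin: "finite (pverts (prism \<pi> G))"
    using pair_finite_verts by (simp add: prism_def)
  show ?thesis
  proof
    show "finite (parcs (prism \<pi> G))"
      using finite_subset[OF sub] fin by simp
    show "symmetric (with_proj (prism \<pi> G))"
      using sym by (simp add: symmetric_def)
    show "finite (pverts (prism \<pi> G))" by (fact fin)
  next
    fix e assume e: "e \<in> parcs (prism \<pi> G)"
    show "fst e \<in> pverts (prism \<pi> G)" "snd e \<in> pverts (prism \<pi> G)"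
      using subsetD[OF sub e] by (simp_all add: mem_Times_iff)
    show "fst e \<noteq> snd e"
      using loops[of "fst e"] e by (metis prod.collapse)
  qed
qed

lemma dominating_set_pverts:
  assumes "pair_graph H"
  shows "dominating_set H (pverts H)"
proof -
  interpret pair_graph H by fact
  show ?thesis
    unfolding dominating_set_def closed_nbhd_def using in_arcsD2 by blast
qed

lemma p_dominating_set_pverts:
  assumes "pair_graph H" and "pverts H \<noteq> {}" and "p \<le> 1"
  shows "p_dominating_set p H (pverts H)"
proof -
  interpret pair_graph H by fact
  have "card (pverts H) \<noteq> 0" using assms(2) pair_finite_verts by simp
  moreover have "closed_nbhd H (pverts H) = pverts H"
    using dominating_set_pverts[OF assms(1)] by (simp add: dominating_set_def)
  ultimately show ?thesis
    using assms(3) by (simp add: p_dominating_set_def)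
qed

end

theory Submission
  imports Defs
begin

text \<open>
  A minimum dominating set \<open>S\<close> of \<open>G\<close>, placed in the first copy inside the prism, dominates that
  whole copy, and through the matching edges it also dominates the \<open>\<gamma>(G)\<close> vertices of
  \<open>\<pi> ` S\<close> in the second copy. It thus dominates exactly \<open>n + \<gamma>(G)\<close> of the \<open>2n\<close> vertices of
  the prism, which is the proportion that bounds \<open>p\<close>.
\<close>

lemma obtain_minimum_dominating_set:
  assumes "pair_graph H"
  obtains S where "dominating_set H S" and "card S = domination_number H"
proof -
  have "\<exists>k S. dominating_set H S \<and> card S = k"
    using dominating_set_pverts[OF assms] by blast
  from LeastI_ex[OF this] show ?thesis
    using that unfolding domination_number_def by blast
qed

lemma p_domination_number_le_card:
  "p_dominating_set p H S \<Longrightarrow> p_domination_number p H \<le> card S"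
  unfolding p_domination_number_def by (rule Least_le) blast

text \<open>
  The only arcs from the first copy to the second are the matching arcs from \<open>v\<close> to \<open>\<pi> v\<close>.
\<close>

lemma closed_nbhd_prism_Inl:
  assumes "S \<subseteq> pverts G"
  shows "closed_nbhd (prism \<pi> G) (Inl ` S) = closed_nbhd G S <+> \<pi> ` S"
  using assms unfolding closed_nbhd_def prism_def by auto

theorem proposition3p2:
  fixes G :: "'a pair_pre_digraph" and n :: nat and \<pi> :: "'a \<Rightarrow> 'a" and p :: real
  assumes "pair_graph G"
    and "card (pverts G) = n"
    and "\<pi> permutes pverts G"
    and "p \<in> {0 <.. (real n + real (domination_number G)) / (2 * real n)}"
  shows "p_domination_number p (prism \<pi> G) \<le> domination_number G"
proof -
  interpret pair_graph G by fact
  obtain S where S: "dominating_set G S" "card S = domination_number G"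
    using obtain_minimum_dominating_set[OF assms(1)] .
  then have sub: "S \<subseteq> pverts G" and dom: "closed_nbhd G S = pverts G"
    by (simp_all add: dominating_set_def)
  have "finite S"
    using sub pair_finite_verts by (rule finite_subset)
  have "card (\<pi> ` S) = card S"
    using permutes_inj_on[OF assms(3)] by (rule card_image)
  then have nbhd: "card (closed_nbhd (prism \<pi> G) (Inl ` S)) = n + domination_number G"
    using \<open>finite S\<close> S(2) assms(2) pair_finite_verts
    by (simp add: closed_nbhd_prism_Inl[OF sub] dom card_Plus)
  have "card (pverts (prism \<pi> G)) = 2 * n"
    using assms(2) pair_finite_verts by (simp add: prism_def card_Plus)
  moreover have "Inl ` S \<subseteq> pverts (prism \<pi> G)"
    using sub by (auto simp: prism_def)
  ultimately have "p_dominating_set p (prism \<pi> G) (Inl ` S)"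
    using assms(4) nbhd by (simp add: p_dominating_set_def)
  then have "p_domination_number p (prism \<pi> G) \<le> card (Inl ` S :: ('a + 'a) set)"
    by (rule p_domination_number_le_card)
  also have "\<dots> = domination_number G"
    using S(2) by (simp add: card_image)
  finally show ?thesis .
qed

end
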